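(* For any $d,n>0$ and any $0<\varepsilon<1/d$, the Generalized Subset Sum problem with coefficient set $C=[-d:d]$ on inputs $(\mathbf{x},\tau)$ with $\mathbf{x}\in\mathbb{Z}^n$ can be solved by a single call to a $(1+1/d-\varepsilon)$-approximate $\mathrm{CVP}_\infty$ oracle in dimension $n+1$ (plus polynomial-time additional work).
   Context: $[-d:d]=\{-d,\dots,d\}$. Generalized Subset Sum with coefficient set $C$: given $\mathbf{x}\in\mathbb{Z}^n$ (with entries in $[0,M-1]$) and a target $\tau\in\mathbb{Z}$, output $\mathbf{c}\in C^n$ with $\mathbf{c}\cdot\mathbf{x}=\tau$ if one exists, otherwise report that none exists. A $\gamma$-approximate $\mathrm{CVP}_\infty$ oracle in dimension $m$, given a lattice $L\subseteq\mathbb{R}^m$ (by a basis) and a target $\mathbf{t}\in\mathbb{R}^m$, returns $\mathbf{v}\in L$ with $\|\mathbf{v}-\mathbf{t}\|_\infty\le\gamma\min_{\mathbf{w}\in L}\|\mathbf{w}-\mathbf{t}\|_\infty$. *)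

theory Defs
  imports
    "Jordan_Normal_Form.VS_Connect"
    "HOL-Computational_Algebra.Polynomial"
    "HOL-Library.Log_Nat"
begin

section \<open>Generalized Subset Sum\<close>

definition gss_solutions :: "int set \<Rightarrow> int vec \<Rightarrow> int \<Rightarrow> int vec set" where
  "gss_solutions C x \<tau> =
     {c \<in> carrier_vec (dim_vec x). (\<forall>i < dim_vec x. c $ i \<in> C) \<and> c \<bullet> x = \<tau>}"

text \<open>An answer is either a coefficient vector or (\<^term>\<open>None\<close>) the report that there is none.\<close>

definition solves_gss :: "int set \<Rightarrow> int vec \<Rightarrow> int \<Rightarrow> int vec option \<Rightarrow> bool" where
  "solves_gss C x \<tau> answer =
     (case answer of
        None \<Rightarrow> gss_solutions C x \<tau> = {}
      | Some c \<Rightarrow> c \<in> gss_solutions C x \<tau>)"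


section \<open>Approximate closest vector oracles for the maximum norm\<close>

definition linf_norm :: "real vec \<Rightarrow> real" where
  "linf_norm v = Max (insert 0 ((\<lambda>i. \<bar>v $ i\<bar>) ` {..<dim_vec v}))"

text \<open>A basis of a lattice in \<open>\<real>\<^sup>m\<close>: linearly independent over the reals, of any rank up to \<open>m\<close>.
  The lattice it generates is the library's \<^const>\<open>vec_module.lattice_of\<close>, the set of all integer
  combinations.\<close>

definition lattice_basis :: "nat \<Rightarrow> real vec list \<Rightarrow> bool" where
  "lattice_basis m B \<longleftrightarrow>
     set B \<subseteq> carrier_vec m \<and> distinct B \<and>
     \<not> module.lin_dep class_ring (module_vec TYPE(real) m) (set B)"

type_synonym cvp_oracle = "real vec list \<Rightarrow> real vec \<Rightarrow> real vec"

text \<open>The infimum below is a minimum, since lattices are discrete.\<close>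

definition approx_cvp_oracle :: "real \<Rightarrow> nat \<Rightarrow> cvp_oracle \<Rightarrow> bool" where
  "approx_cvp_oracle \<gamma> m orc \<longleftrightarrow>
     (\<forall>B t. lattice_basis m B \<longrightarrow> t \<in> carrier_vec m \<longrightarrow>
        orc B t \<in> vec_module.lattice_of m B \<and>
        linf_norm (orc B t - t) \<le> \<gamma> * (INF w \<in> vec_module.lattice_of m B. linf_norm (w - t)))"


section \<open>Programs with oracles and logarithmic cost\<close>

text \<open>
  The machine model is a random access machine with logarithmic cost, presented as a structured
  language. The memory consists of named integer arrays (of which a program mentions only finitely
  many); a scalar variable is cell 0 of an array. Every operation is charged the bit lengths of
  the integers and addresses that it handles, so polynomial time here agrees with polynomial time
  on Turing machines.
\<close>

type_synonym name = string
type_synonym memory = "name \<Rightarrow> int \<Rightarrow> int"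

definition bits :: "int \<Rightarrow> nat" where
  "bits z = nat (bitlen \<bar>z\<bar>) + 1"

definition vec_bits :: "int vec \<Rightarrow> nat" where
  "vec_bits v = (\<Sum>i < dim_vec v. bits (v $ i))"

datatype aexp =
    Const int
  | Cell name aexp
  | Plus aexp aexp
  | Minus aexp aexp
  | Times aexp aexp

datatype bexp =
    Less aexp aexp
  | Not bexp
  | And bexp bexp

fun aval :: "memory \<Rightarrow> aexp \<Rightarrow> int" where
  "aval s (Const z) = z"
| "aval s (Cell a e) = s a (aval s e)"
| "aval s (Plus e f) = aval s e + aval s f"
| "aval s (Minus e f) = aval s e - aval s f"
| "aval s (Times e f) = aval s e * aval s f"

text \<open>The operands and addresses are paid for in the recursive calls.\<close>

fun acost :: "memory \<Rightarrow> aexp \<Rightarrow> nat" where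
  "acost s (Const z) = bits z"
| "acost s (Cell a e) = acost s e + bits (aval s (Cell a e))"
| "acost s (Plus e f) = acost s e + acost s f + bits (aval s (Plus e f))"
| "acost s (Minus e f) = acost s e + acost s f + bits (aval s (Minus e f))"
| "acost s (Times e f) = acost s e + acost s f + bits (aval s (Times e f))"

fun bval :: "memory \<Rightarrow> bexp \<Rightarrow> bool" where
  "bval s (Less e f) = (aval s e < aval s f)"
| "bval s (Not b) = (\<not> bval s b)"
| "bval s (And b c) = (bval s b \<and> bval s c)"

fun bcost :: "memory \<Rightarrow> bexp \<Rightarrow> nat" where
  "bcost s (Less e f) = acost s e + acost s f"
| "bcost s (Not b) = bcost s b + 1"
| "bcost s (And b c) = bcost s b + bcost s c + 1"

text \<open>
  \<open>Assign a e f\<close> is the assignment \<open>a[e] := f\<close>. \<open>Query b k t a\<close> asks for a lattice vector close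
  to a target: the \<open>k\<close> basis vectors are stored one after another in the array \<open>b\<close>, the target is
  stored in the array \<open>t\<close>, and the reply is written to the array \<open>a\<close>.
\<close>

datatype com =
    Skip
  | Assign name aexp aexp
  | Seq com com
  | If bexp com com
  | While bexp com
  | Query name aexp name name

definition read_vec :: "nat \<Rightarrow> memory \<Rightarrow> name \<Rightarrow> int \<Rightarrow> int vec" where
  "read_vec m s a i = vec m (\<lambda>j. s a (i + int j))"

definition read_basis :: "nat \<Rightarrow> memory \<Rightarrow> name \<Rightarrow> nat \<Rightarrow> int vec list" where
  "read_basis m s b k = map (\<lambda>i. read_vec m s b (int (i * m))) [0..<k]"

definition write_vec :: "int vec \<Rightarrow> name \<Rightarrow> memory \<Rightarrow> memory" where
  "write_vec v a s =
     s(a := (\<lambda>i. if 0 \<le> i \<and> i < int (dim_vec v) then v $ nat i else s a i))"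

text \<open>
  \<open>exec m orc P s T q s'\<close>: with queries in dimension \<open>m\<close> answered by \<open>orc\<close>, program \<open>P\<close> started in memory \<open>s\<close>
  terminates in memory \<open>s'\<close> after \<open>T\<close> time units and \<open>q\<close> queries.
  As memory cells hold integers, only integral bases and targets can be queried, for which all
  lattice vectors are integral; execution gets stuck on a query that is not a lattice basis or
  whose reply is not integral. A query is charged for writing the query and reading the reply.
\<close>

inductive exec :: "nat \<Rightarrow> cvp_oracle \<Rightarrow> com \<Rightarrow> memory \<Rightarrow> nat \<Rightarrow> nat \<Rightarrow> memory \<Rightarrow> bool"
  for m :: nat and orc :: cvp_oracle where
  Skip: "exec m orc Skip s 1 0 s"
| Assign: "exec m orc (Assign a e f) s (acost s e + acost s f) 0
             (s(a := (s a)(aval s e := aval s f)))"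
| Seq: "exec m orc P s T q s' \<Longrightarrow> exec m orc Q s' T' q' s'' \<Longrightarrow>
        exec m orc (Seq P Q) s (T + T') (q + q') s''"
| IfTrue: "bval s b \<Longrightarrow> exec m orc P s T q s' \<Longrightarrow>
           exec m orc (If b P Q) s (bcost s b + T) q s'"
| IfFalse: "\<not> bval s b \<Longrightarrow> exec m orc Q s T q s' \<Longrightarrow>
            exec m orc (If b P Q) s (bcost s b + T) q s'"
| WhileFalse: "\<not> bval s b \<Longrightarrow> exec m orc (While b P) s (bcost s b) 0 s"
| WhileTrue: "bval s b \<Longrightarrow> exec m orc P s T q s' \<Longrightarrow> exec m orc (While b P) s' T' q' s'' \<Longrightarrow>
              exec m orc (While b P) s (bcost s b + T + T') (q + q') s''"
| Query: "B = read_basis m s b (nat (aval s k)) \<Longrightarrow> y = read_vec m s t 0 \<Longrightarrow>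
          lattice_basis m (map (map_vec real_of_int) B) \<Longrightarrow>
          orc (map (map_vec real_of_int) B) (map_vec real_of_int y) = map_vec real_of_int v \<Longrightarrow>
          exec m orc (Query b k t a) s
            (acost s k + sum_list (map vec_bits B) + vec_bits y + vec_bits v) 1 (write_vec v a s)"

text \<open>Execution is deterministic: memory, time and number of queries are functions of the input.\<close>

lemma exec_deterministic:
  assumes "exec m orc P s T q s'" and "exec m orc P s T' q' s''"
  shows "T = T' \<and> q = q' \<and> s' = s''"
proof -
  have inj: "v = w" if "map_vec real_of_int v = map_vec real_of_int w" for v w
    using that by (rule of_int_hom.vec_hom_inj)
  show ?thesis
    using assms
  proof (induction arbitrary: T' q' s'' rule: exec.induct)
    case (Query B s b k y t v a)
    from Query.prems show ?case
    proof (cases rule: exec.cases)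
      case (Query B' y' v')
      with Query.hyps have "map_vec real_of_int v = map_vec real_of_int v'" by simp
      then have "v = v'" by (rule inj)
      with Query Query.hyps show ?thesis by simp
    qed
  next
    case (Seq P s T q s1 Q T1 q1 s2)
    from Seq.prems show ?case by cases (use Seq.IH in blast)
  next
    case (WhileTrue s b P T q s1 T1 q1 s2)
    from WhileTrue.prems show ?case by cases (use WhileTrue.hyps WhileTrue.IH in blast)+
  qed (erule exec.cases; auto)+
qed


section \<open>Input and output of programs for Generalized Subset Sum\<close>

definition gss_input :: "nat \<Rightarrow> nat \<Rightarrow> int vec \<Rightarrow> int \<Rightarrow> memory" where
  "gss_input d n x \<tau> =
     (\<lambda>_ _. 0)
       (''d'' := (\<lambda>_. 0)(0 := int d),
        ''n'' := (\<lambda>_. 0)(0 := int n),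
        ''tau'' := (\<lambda>_. 0)(0 := \<tau>),
        ''x'' := (\<lambda>i. if 0 \<le> i \<and> i < int (dim_vec x) then x $ nat i else 0))"

definition gss_input_bits :: "nat \<Rightarrow> nat \<Rightarrow> int vec \<Rightarrow> int \<Rightarrow> nat" where
  "gss_input_bits d n x \<tau> = bits (int d) + bits (int n) + bits \<tau> + vec_bits x"

definition gss_output :: "nat \<Rightarrow> memory \<Rightarrow> int vec option" where
  "gss_output n s = (if s ''found'' 0 = 1 then Some (read_vec n s ''c'' 0) else None)"

end

theory Submission
  imports Defs
begin

text \<open>
  Query the lattice spanned by the vectors \<open>e\<^sub>i + (d + 1) x\<^sub>i e\<^sub>n\<close>, whose points are
  \<open>(c, (d + 1) (c \<bullet> x))\<close>, with target \<open>(0, (d + 1) \<tau>)\<close>. A solution \<open>c\<close> of the subset sum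
  instance is a lattice point at distance at most \<open>d\<close>, so if one exists, then the reply is at
  distance at most \<open>(1 + 1/d - \<epsilon>) d < d + 1\<close>. By integrality its first \<open>n\<close> coordinates
  lie in \<open>[-d, d]\<close>, and its last one, a multiple of \<open>d + 1\<close> away from that of the target, is
  exact; hence the reply is itself a solution. Comparison with the lattice point \<open>0\<close> shows that the
  entries of any reply are at most \<open>3 (d + 1) |\<tau>|\<close>, so reading and checking it is cheap.
\<close>

section \<open>The lattice\<close>

text \<open>Every vector of \<open>X\<close> has a pivot coordinate at which all the others vanish.
  Read at the pivot of \<open>v\<close>, a vanishing combination reduces to
  \<open>a v * v $ i = 0\<close>.\<close>

lemma lin_indpt_coordinates:
  fixes X :: "real vec set"
  assumes X: "X \<subseteq> carrier_vec m"
    and pivot: "\<And>v. v \<in> X \<Longrightarrow> \<exists>i<m. v $ i \<noteq> 0 \<and> (\<forall>w\<in>X. w \<noteq> v \<longrightarrow> w $ i = 0)"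
  shows "\<not> module.lin_dep class_ring (module_vec TYPE(real) m) X"
proof
  interpret vec_space "TYPE(real)" m .
  assume "lin_dep X"
  then obtain A a v where A: "finite A" "A \<subseteq> X" "lincomb a A = 0\<^sub>v m" "v \<in> A" "a v \<noteq> 0"
    unfolding lin_dep_def by auto
  with pivot obtain i where i: "i < m" "v $ i \<noteq> 0" "\<forall>w\<in>X. w \<noteq> v \<longrightarrow> w $ i = 0"
    by (meson subsetD)
  have "0 = (\<Sum>w\<in>A. a w * w $ i)"
    using lincomb_index[of i A a] A X i(1) by auto
  also have "\<dots> = (\<Sum>w\<in>A. if w = v then a v * v $ i else 0)"
    using A(2) i(3) by (intro sum.cong) auto
  also have "\<dots> = a v * v $ i"
    using A by simp
  finally show False
    using A(5) i(2) by simp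
qed

lemma linf_norm_le_iff:
  assumes "0 \<le> r"
  shows "linf_norm v \<le> r \<longleftrightarrow> (\<forall>i < dim_vec v. \<bar>v $ i\<bar> \<le> r)"
  using assms by (auto simp: linf_norm_def)

lemma linf_norm_nonneg: "0 \<le> linf_norm v"
  by (simp add: linf_norm_def)

section \<open>The basis, the target and the points of the queried lattice\<close>

definition gss_basis :: "nat \<Rightarrow> int vec \<Rightarrow> int vec list" where
  "gss_basis d x = map (\<lambda>i. vec (dim_vec x + 1)
     (\<lambda>j. if j = i then 1 else if j = dim_vec x then (int d + 1) * x $ i else 0)) [0..<dim_vec x]"

definition gss_target :: "nat \<Rightarrow> nat \<Rightarrow> int \<Rightarrow> int vec" where
  "gss_target d n \<tau> = vec (n + 1) (\<lambda>j. if j = n then (int d + 1) * \<tau> else 0)"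

text \<open>The lattice point with coefficient vector \<open>c\<close>, kept over the integers
  because a query gets stuck on a reply that is not integral.\<close>

definition gss_point :: "nat \<Rightarrow> int vec \<Rightarrow> int vec \<Rightarrow> int vec" where
  "gss_point d x c = vec (dim_vec x + 1)
     (\<lambda>j. if j < dim_vec x then c $ j else (int d + 1) * (c \<bullet> x))"

text \<open>The first \<open>dim_vec x\<close> coordinates of the basis vectors form an identity
  matrix, so coordinate \<open>i\<close> is a pivot of vector \<open>i\<close>.\<close>

lemma lattice_basis_gss_basis:
  "lattice_basis (dim_vec x + 1) (map (map_vec real_of_int) (gss_basis d x))"
proof -
  let ?B = "map (map_vec real_of_int) (gss_basis d x)"
  have nth: "?B ! i $ j = (if j = i then 1 else 0)" if "i < dim_vec x" "j < dim_vec x" for i j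
    using that by (simp add: gss_basis_def)
  have len: "length ?B = dim_vec x"
    by (simp add: gss_basis_def)
  have carrier: "set ?B \<subseteq> carrier_vec (dim_vec x + 1)"
    by (auto simp: gss_basis_def)
  moreover have "distinct ?B"
    unfolding distinct_conv_nth len using nth by (metis zero_neq_one)
  moreover have "\<exists>i<dim_vec x + 1. v $ i \<noteq> 0 \<and> (\<forall>w\<in>set ?B. w \<noteq> v \<longrightarrow> w $ i = 0)"
    if v: "v \<in> set ?B" for v
  proof -
    obtain i where i: "i < dim_vec x" "?B ! i = v"
      using v unfolding in_set_conv_nth len by blast
    have "w $ i = 0" if w: "w \<in> set ?B" "w \<noteq> v" for w
    proof -
      obtain k where k: "k < dim_vec x" "?B ! k = w"
        using w(1) unfolding in_set_conv_nth len by blast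
      then have "i \<noteq> k"
        using w(2) i(2) by blast
      with nth[OF k(1) i(1)] k(2) show ?thesis
        by simp
    qed
    then show ?thesis
      using i(1) nth[OF i(1) i(1)] unfolding i(2) by (intro exI[of _ i]) auto
  qed
  ultimately show ?thesis
    unfolding lattice_basis_def using lin_indpt_coordinates by blast
qed

text \<open>The identity block reproduces the coefficients, so they can be read off a lattice point;
  the last coordinate is linear in them.\<close>

lemma lattice_of_gss_basis:
  assumes x: "x \<in> carrier_vec n"
  shows "vec_module.lattice_of (n + 1) (map (map_vec real_of_int) (gss_basis d x)) =
    (\<lambda>c. map_vec real_of_int (gss_point d x c)) ` carrier_vec n"
proof -
  interpret vec_module "TYPE(real)" "n + 1" .
  let ?B = "map (map_vec real_of_int) (gss_basis d x)"
  have len: "length ?B = n"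
    using x by (simp add: gss_basis_def)
  have eq: "sumlist (map (\<lambda>i. of_int (c i) \<cdot>\<^sub>v ?B ! i) [0..<length ?B])
      = map_vec real_of_int (gss_point d x (vec n c))" (is "?l = ?r") for c
  proof (rule eq_vecI)
    have B: "?B ! i \<in> carrier_vec (n + 1)" if "i < n" for i
      using that x by (simp add: gss_basis_def)
    then have l: "?l \<in> carrier_vec (n + 1)"
      unfolding len by (intro M.sumlist_carrier) auto
    then show "dim_vec ?l = dim_vec ?r"
      using x by (simp add: gss_point_def)
    fix j assume "j < dim_vec ?r"
    then have j: "j < n + 1"
      using x by (simp add: gss_point_def)
    have "?l $ j = (\<Sum>i = 0..<n. (of_int (c i) \<cdot>\<^sub>v ?B ! i) $ j)"
      using B j len by (subst sumlist_nth) (auto intro!: sum.cong)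
    also have "\<dots> = (\<Sum>i = 0..<n. of_int (c i) * ?B ! i $ j)"
      using carrier_vecD[OF B] j by (intro sum.cong refl index_smult_vec) simp
    also have "\<dots> = (\<Sum>i = 0..<n. real_of_int (c i *
        (if j = i then 1 else if j = n then (int d + 1) * x $ i else 0)))"
      using x j by (intro sum.cong) (auto simp: gss_basis_def)
    also have "\<dots> = ?r $ j"
    proof (cases "j = n")
      case True
      then have "(\<Sum>i = 0..<n. real_of_int (c i *
          (if j = i then 1 else if j = n then (int d + 1) * x $ i else 0)))
        = (\<Sum>i = 0..<n. real_of_int ((int d + 1) * (c i * x $ i)))"
        by (intro sum.cong) auto
      then show ?thesis
        using True x by (simp add: gss_point_def scalar_prod_def sum_distrib_left)
    next
      case False
      then have "(\<Sum>i = 0..<n. real_of_int (c i *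
          (if j = i then 1 else if j = n then (int d + 1) * x $ i else 0)))
        = (\<Sum>i = 0..<n. if j = i then real_of_int (c j) else 0)"
        by (intro sum.cong) auto
      then show ?thesis
        using False j x by (simp add: gss_point_def)
    qed
    finally show "?l $ j = ?r $ j" .
  qed
  show ?thesis
  proof (intro equalityI subsetI)
    fix v assume "v \<in> lattice_of ?B"
    then obtain c where "v = sumlist (map (\<lambda>i. of_int (c i) \<cdot>\<^sub>v ?B ! i) [0..<length ?B])"
      by (rule in_latticeE)
    then show "v \<in> (\<lambda>c. map_vec real_of_int (gss_point d x c)) ` carrier_vec n"
      unfolding eq by (intro image_eqI[of _ _ "vec n c"]) auto
  next
    fix v assume "v \<in> (\<lambda>c. map_vec real_of_int (gss_point d x c)) ` carrier_vec n"
    then obtain c where c: "c \<in> carrier_vec n" "v = map_vec real_of_int (gss_point d x c)"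
      by auto
    moreover have "vec n (($) c) = c"
      using c(1) by auto
    ultimately show "v \<in> lattice_of ?B"
      by (intro in_latticeI[of _ "($) c"]) (simp only: eq)
  qed
qed

text \<open>Collects what the program needs of a reply: it is integral, so the query does not get
  stuck; its entries are bounded, so reading it is cheap; and the test that the program performs on
  it decides the instance.\<close>

lemma gss_oracle_reply:
  assumes d: "0 < d" and \<epsilon>: "0 < \<epsilon>" "\<epsilon> < 1 / real d"
    and orc: "approx_cvp_oracle (1 + 1 / real d - \<epsilon>) (n + 1) orc"
    and x: "x \<in> carrier_vec n"
  shows "\<exists>v. v \<in> carrier_vec (n + 1) \<and>
    orc (map (map_vec real_of_int) (gss_basis d x)) (map_vec real_of_int (gss_target d n \<tau>))
      = map_vec real_of_int v \<and>
    (\<forall>i\<le>n. \<bar>v $ i\<bar> \<le> 3 * ((int d + 1) * \<bar>\<tau>\<bar>)) \<and>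
    solves_gss {- int d .. int d} x \<tau>
      (if v $ n = (int d + 1) * \<tau> \<and> (\<forall>i<n. \<bar>v $ i\<bar> \<le> int d) then Some (vec n (($) v)) else None)"
proof -
  let ?\<gamma> = "1 + 1 / real d - \<epsilon>"
  let ?p = "\<lambda>c. map_vec real_of_int (gss_point d x c)"
  let ?t = "map_vec real_of_int (gss_target d n \<tau>)"
  let ?reply = "orc (map (map_vec real_of_int) (gss_basis d x)) ?t"
  have lat: "vec_module.lattice_of (n + 1) (map (map_vec real_of_int) (gss_basis d x))
      = ?p ` carrier_vec n"
    using x by (rule lattice_of_gss_basis)
  have "lattice_basis (n + 1) (map (map_vec real_of_int) (gss_basis d x))"
    using lattice_basis_gss_basis[of x d] x by simp
  moreover have "?t \<in> carrier_vec (n + 1)"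
    by (simp add: gss_target_def)
  ultimately have "?reply \<in> ?p ` carrier_vec n \<and>
    linf_norm (?reply - ?t) \<le> ?\<gamma> * (INF w\<in>?p ` carrier_vec n. linf_norm (w - ?t))"
    using orc[unfolded approx_cvp_oracle_def, rule_format] unfolding lat[symmetric] by blast
  then have reply: "?reply \<in> ?p ` carrier_vec n"
    "linf_norm (?reply - ?t) \<le> ?\<gamma> * (INF w\<in>?p ` carrier_vec n. linf_norm (w - ?t))"
    by blast+
  then obtain c where c: "c \<in> carrier_vec n" "?reply = ?p c"
    by auto
  \<comment> \<open>The sign allows multiplying distances by the factor; the bound 2 keeps the size
    of the reply independent of \<epsilon>.\<close>
  have \<gamma>: "0 \<le> ?\<gamma>" "?\<gamma> \<le> 2"
  proof -
    have "1 / real d \<le> 1"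
      using d by simp
    then show "0 \<le> ?\<gamma>" "?\<gamma> \<le> 2"
      using \<epsilon> by linarith+
  qed
  \<comment> \<open>Norms are nonnegative, so the infimum is a lower bound and the reply can be
    compared with any chosen lattice point.\<close>
  have dist: "linf_norm (?p c - ?t) \<le> ?\<gamma> * linf_norm (?p c' - ?t)" if "c' \<in> carrier_vec n" for c'
  proof -
    have "(INF w\<in>?p ` carrier_vec n. linf_norm (w - ?t)) \<le> linf_norm (?p c' - ?t)"
      by (rule cINF_lower[OF bdd_belowI2[of _ 0]]) (use that linf_norm_nonneg in blast)+
    from mult_left_mono[OF this \<gamma>(1)] show ?thesis
      using reply(2) unfolding c(2) by (rule order_trans[rotated])
  qed
  have diff: "dim_vec (?p c' - ?t) = n + 1"
    "i < n \<Longrightarrow> (?p c' - ?t) $ i = real_of_int (c' $ i)"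
    "(?p c' - ?t) $ n = real_of_int ((int d + 1) * (c' \<bullet> x - \<tau>))" for c' i
    using x by (auto simp: gss_point_def gss_target_def algebra_simps)
  have norm_le: "linf_norm (?p c' - ?t) \<le> r \<longleftrightarrow>
      (\<forall>i<n. real_of_int \<bar>c' $ i\<bar> \<le> r) \<and> real_of_int \<bar>(int d + 1) * (c' \<bullet> x - \<tau>)\<bar> \<le> r"
    if "0 \<le> r" for c' r
    using that by (auto simp: linf_norm_le_iff diff less_Suc_eq simp del: index_minus_vec)
  let ?v = "gss_point d x c"
  let ?K = "int d + 1"
  \<comment> \<open>The lattice point 0 is at distance \<open>?K * \<bar>\<tau>\<bar>\<close>, so
    the reply differs from the target by at most twice that; in the last coordinate the target
    itself adds it once more, whence the 3.\<close>
  have small: "\<bar>?v $ i\<bar> \<le> 3 * (?K * \<bar>\<tau>\<bar>)" if "i \<le> n" for i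
  proof -
    let ?r = "real_of_int (?K * \<bar>\<tau>\<bar>)"
    have "linf_norm (?p (0\<^sub>v n) - ?t) \<le> ?r"
      using x by (subst norm_le) (auto simp: abs_mult)
    then have "?\<gamma> * linf_norm (?p (0\<^sub>v n) - ?t) \<le> 2 * ?r"
      using \<gamma>(2) linf_norm_nonneg by (intro mult_mono) auto
    then have "linf_norm (?p c - ?t) \<le> real_of_int (2 * (?K * \<bar>\<tau>\<bar>))"
      unfolding of_int_mult[of 2] of_int_numeral by (rule order_trans[OF dist[OF zero_carrier_vec]])
    moreover have "0 \<le> real_of_int (2 * (?K * \<bar>\<tau>\<bar>))"
      by simp
    ultimately have b: "\<forall>i<n. \<bar>c $ i\<bar> \<le> 2 * (?K * \<bar>\<tau>\<bar>)" "\<bar>?K * (c \<bullet> x - \<tau>)\<bar> \<le> 2 * (?K * \<bar>\<tau>\<bar>)"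
      using norm_le[of "real_of_int (2 * (?K * \<bar>\<tau>\<bar>))" c] unfolding of_int_le_iff by blast+
    have "\<bar>?K * (c \<bullet> x)\<bar> \<le> \<bar>?K * (c \<bullet> x - \<tau>)\<bar> + \<bar>?K * \<tau>\<bar>"
      by (simp add: algebra_simps)
    moreover have "\<bar>?K * \<tau>\<bar> = ?K * \<bar>\<tau>\<bar>"
      by (simp add: abs_mult)
    moreover have "0 \<le> ?K * \<bar>\<tau>\<bar>"
      by simp
    ultimately have "\<bar>?K * (c \<bullet> x)\<bar> \<le> 3 * (?K * \<bar>\<tau>\<bar>)" and "2 * (?K * \<bar>\<tau>\<bar>) \<le> 3 * (?K * \<bar>\<tau>\<bar>)"
      using b(2) by linarith+
    moreover have "?v $ i = (if i < n then c $ i else ?K * (c \<bullet> x))"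
      using that x by (simp add: gss_point_def)
    ultimately show ?thesis
      using b(1) by (cases "i < n") auto
  qed
  have "solves_gss {- int d .. int d} x \<tau>
      (if ?v $ n = ?K * \<tau> \<and> (\<forall>i<n. \<bar>?v $ i\<bar> \<le> int d) then Some (vec n (($) ?v)) else None)"
  proof -
    have K: "?v $ n = ?K * \<tau> \<longleftrightarrow> c \<bullet> x = \<tau>"
      using x by (simp add: gss_point_def)
    have vi: "?v $ i = c $ i" if "i < n" for i
      using that x by (simp add: gss_point_def)
    have vc: "vec n (($) ?v) = c"
      using c(1) vi by auto
    \<comment> \<open>The test is equivalent to \<open>c\<close> being a solution. So a returned
      vector is always right, and only the answer \<open>None\<close> depends on the quality of the
      approximation.\<close>
    have sol: "c \<in> gss_solutions {- int d .. int d} x \<tau> \<longleftrightarrow>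
        ?v $ n = ?K * \<tau> \<and> (\<forall>i<n. \<bar>?v $ i\<bar> \<le> int d)"
      using c(1) x vi unfolding K by (auto simp: gss_solutions_def abs_le_iff)
    have "c \<in> gss_solutions {- int d .. int d} x \<tau>"
      if c': "c' \<in> gss_solutions {- int d .. int d} x \<tau>" for c'
    proof -
      from c' x have c'': "c' \<in> carrier_vec n" "c' \<bullet> x = \<tau>" "\<forall>i<n. \<bar>c' $ i\<bar> \<le> int d"
        by (auto simp: gss_solutions_def abs_le_iff)
      then have "linf_norm (?p c' - ?t) \<le> real d"
        by (subst norm_le) auto
      then have le: "linf_norm (?p c - ?t) \<le> ?\<gamma> * real d"
        using dist[OF c''(1)] mult_left_mono[OF _ \<gamma>(1)] order_trans by blast
      \<comment> \<open>Multiplied out, the radius is d + 1 - \<epsilon> d.\<close>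
      have \<gamma>d: "0 \<le> ?\<gamma> * real d" "?\<gamma> * real d < real_of_int ?K"
        using mult_nonneg_nonneg[OF \<gamma>(1), of "real d"] d \<epsilon>(1) by (simp_all add: algebra_simps)
      have less: "\<bar>z\<bar> < ?K" if "real_of_int \<bar>z\<bar> \<le> ?\<gamma> * real d" for z
        using that \<gamma>d(2) by linarith
      \<comment> \<open>For integers, absolute value below d + 1 means at most d, and a multiple of
        \<open>?K\<close> of absolute value below \<open>?K\<close> is 0.\<close>
      have "\<forall>i<n. \<bar>c $ i\<bar> < ?K" "\<bar>?K * (c \<bullet> x - \<tau>)\<bar> < ?K"
        using le less unfolding norm_le[OF \<gamma>d(1)] by blast+
      moreover from this(2) have "?K * \<bar>c \<bullet> x - \<tau>\<bar> < ?K * 1"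
        by (simp add: abs_mult)
      then have "c \<bullet> x = \<tau>"
        by (subst (asm) mult_less_cancel_left_pos) auto
      ultimately show ?thesis
        unfolding sol K using vi by auto
    qed
    then show ?thesis
      unfolding sol vc by (auto simp: solves_gss_def sol)
  qed
  moreover have "?v \<in> carrier_vec (n + 1)"
    using x by (simp add: gss_point_def)
  ultimately show ?thesis
    using c(2) small by blast
qed


section \<open>Costs\<close>

lemma bits_le_iff: "bits z \<le> Suc k \<longleftrightarrow> \<bar>z\<bar> < 2 ^ k"
proof -
  have "bits z \<le> Suc k \<longleftrightarrow> bitlen \<bar>z\<bar> \<le> int k"
    by (auto simp: bits_def)
  also have "\<dots> \<longleftrightarrow> \<bar>z\<bar> < 2 ^ k"
    by (simp add: bitlen_le_iff_power)
  finally show ?thesis .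
qed

lemma bits_pos: "1 \<le> bits z"
  by (simp add: bits_def)

lemma bits_mono: "\<bar>y\<bar> \<le> \<bar>z\<bar> \<Longrightarrow> bits y \<le> bits z"
  using bits_le_iff[of z "bits z - 1"] bits_le_iff[of y "bits z - 1"] bits_pos[of z] by simp

text \<open>The extra unit in each \<open>bits\<close> pays for the carry: 2^p + 2^q is at most 2^(p
  + q + 1). Absolute values let one lemma serve sums and differences.\<close>

lemma bits_add_le_abs:
  assumes "\<bar>w\<bar> \<le> \<bar>y\<bar> + \<bar>z\<bar>"
  shows "bits w \<le> bits y + bits z"
proof -
  obtain p q where p: "bits y = Suc p" "bits z = Suc q"
    using bits_pos[of y] bits_pos[of z] by (metis Suc_le_D One_nat_def)
  then have "\<bar>y\<bar> < 2 ^ p" "\<bar>z\<bar> < 2 ^ q"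
    using bits_le_iff[of y p] bits_le_iff[of z q] by auto
  moreover have "(2::int) ^ p \<le> 2 ^ (p + q)" "(2::int) ^ q \<le> 2 ^ (p + q)"
    by (auto intro: power_increasing)
  moreover have "(2::int) ^ (p + q + 1) = 2 * 2 ^ (p + q)"
    by simp
  ultimately have "\<bar>w\<bar> < 2 ^ (p + q + 1)"
    using assms by linarith
  then show ?thesis
    using bits_le_iff[of w "p + q + 1"] p by simp
qed

lemma bits_mult: "bits (y * z) \<le> bits y + bits z"
proof -
  obtain p q where p: "bits y = Suc p" "bits z = Suc q"
    using bits_pos[of y] bits_pos[of z] by (metis Suc_le_D One_nat_def)
  then have "\<bar>y\<bar> < 2 ^ p" "\<bar>z\<bar> < 2 ^ q"
    using bits_le_iff[of y p] bits_le_iff[of z q] by auto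
  then have "\<bar>y * z\<bar> < 2 ^ (p + q)"
    unfolding abs_mult power_add by (intro mult_strict_mono) auto
  then show ?thesis
    using bits_le_iff[of "y * z" "p + q"] p by simp
qed

section \<open>Cost of expressions when all cells have bounded length\<close>

fun aweight :: "aexp \<Rightarrow> nat" where
  "aweight (Const z) = bits z"
| "aweight (Cell a e) = aweight e + 1"
| "aweight (Plus e f) = aweight e + aweight f + 1"
| "aweight (Minus e f) = aweight e + aweight f + 1"
| "aweight (Times e f) = aweight e + aweight f + 1"

definition cells_le :: "nat \<Rightarrow> memory \<Rightarrow> bool" where
  "cells_le B s \<longleftrightarrow> 1 \<le> B \<and> (\<forall>a z. bits (s a z) \<le> B)"

text \<open>Bit lengths are subadditive under all three operations, products included, so the growth
  depends on the expression only, in units of \<open>B\<close>.\<close>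

lemma bits_aval_le:
  assumes "cells_le B s"
  shows "bits (aval s e) \<le> aweight e * B"
proof (induction e)
  case (Const z)
  then show ?case using assms by (simp add: cells_le_def)
next
  case (Cell a e)
  then show ?case using assms by (simp add: cells_le_def trans_le_add1)
next
  case (Plus e f)
  moreover have "bits (aval s (Plus e f)) \<le> bits (aval s e) + bits (aval s f)"
    by (rule bits_add_le_abs) simp
  ultimately show ?case by (simp add: algebra_simps)
next
  case (Minus e f)
  moreover have "bits (aval s (Minus e f)) \<le> bits (aval s e) + bits (aval s f)"
    by (rule bits_add_le_abs) simp
  ultimately show ?case by (simp add: algebra_simps)
next
  case (Times e f)
  moreover have "bits (aval s (Times e f)) \<le> bits (aval s e) + bits (aval s f)"
    by (simp add: bits_mult)
  ultimately show ?case by (simp add: algebra_simps)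
qed

text \<open>The square absorbs the sum over subexpressions: for weights a and b of the operands, (a
  + b + 1)^2 exceeds a^2 + b^2 by at least a + b + 1, the new charge in units of
  \<open>B\<close>.\<close>

lemma acost_le:
  assumes s: "cells_le B s"
  shows "acost s e \<le> (aweight e)\<^sup>2 * B"
proof (induction e)
  case (Const z)
  have "bits z * 1 \<le> bits z * (bits z * B)"
    using s bits_pos[of z] unfolding cells_le_def by (intro mult_le_mono2) simp
  then show ?case by (simp add: power2_eq_square)
next
  case (Cell a e)
  moreover have "bits (s a (aval s e)) \<le> B"
    using s by (simp add: cells_le_def)
  ultimately show ?case
    by (simp add: power2_eq_square algebra_simps)
next
  case (Plus e f)
  then show ?case using bits_aval_le[OF s, of "Plus e f"]
    by (simp add: power2_eq_square algebra_simps)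
next
  case (Minus e f)
  then show ?case using bits_aval_le[OF s, of "Minus e f"]
    by (simp add: power2_eq_square algebra_simps)
next
  case (Times e f)
  then show ?case using bits_aval_le[OF s, of "Times e f"]
    by (simp add: power2_eq_square algebra_simps)
qed

text \<open>Unlike \<open>aweight\<close>, this already counts time in units of \<open>B\<close>,
  hence the squares.\<close>

fun bweight :: "bexp \<Rightarrow> nat" where
  "bweight (Less e f) = (aweight e)\<^sup>2 + (aweight f)\<^sup>2"
| "bweight (Not b) = bweight b + 1"
| "bweight (And b c) = bweight b + bweight c + 1"

lemma bcost_le: "cells_le B s \<Longrightarrow> bcost s b \<le> bweight b * B"
proof (induction b)
  case (Less e f)
  then show ?case using acost_le[of B s e] acost_le[of B s f] by (simp add: algebra_simps)
next
  case (Not b)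
  then show ?case by (simp add: cells_le_def)
next
  case (And b c)
  then show ?case by (simp add: cells_le_def algebra_simps)
qed

section \<open>Memory updates and runs with bounded time\<close>

lemma cells_le_update:
  "cells_le B s \<Longrightarrow> bits y \<le> B \<Longrightarrow> cells_le B (s(a := (s a)(z := y)))"
  by (simp add: cells_le_def)

text \<open>Only an upper bound on the time is kept, as the exact value varies with the memory; the
  number of queries stays exact because exactly one is claimed.\<close>

definition runs :: "nat \<Rightarrow> cvp_oracle \<Rightarrow> com \<Rightarrow> memory \<Rightarrow> nat \<Rightarrow> nat \<Rightarrow> memory \<Rightarrow> bool" where
  "runs m orc P s c q s' \<longleftrightarrow> (\<exists>T\<le>c. exec m orc P s T q s')"

lemma runs_Skip: "cells_le B s \<Longrightarrow> runs m orc Skip s B 0 s"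
  unfolding runs_def cells_le_def using exec.Skip by blast

lemma runs_Assign:
  assumes "cells_le B s" "s' = s(a := (s a)(aval s e := aval s f))"
  shows "runs m orc (Assign a e f) s (((aweight e)\<^sup>2 + (aweight f)\<^sup>2) * B) 0 s'"
  unfolding runs_def assms(2)
  using acost_le[OF assms(1), of e] acost_le[OF assms(1), of f]
  by (intro exI[of _ "acost s e + acost s f"] conjI exec.Assign) (simp add: algebra_simps)

lemma runs_Seq:
  "runs m orc P s c q s' \<Longrightarrow> runs m orc Q s' c' q' s'' \<Longrightarrow>
    runs m orc (Seq P Q) s (c + c') (q + q') s''"
  unfolding runs_def by (meson add_mono exec.Seq)

lemma runs_If:
  assumes "cells_le B s" "runs m orc (if bval s b then P else Q) s c q s'"
  shows "runs m orc (If b P Q) s (bweight b * B + c) q s'"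
proof -
  obtain T where "T \<le> c" "exec m orc (if bval s b then P else Q) s T q s'"
    using assms(2) by (auto simp: runs_def)
  then have "exec m orc (If b P Q) s (bcost s b + T) q s'"
    by (cases "bval s b") (auto intro: exec.IfTrue exec.IfFalse)
  then show ?thesis
    using bcost_le[OF assms(1), of b] \<open>T \<le> c\<close> unfolding runs_def by (meson add_mono)
qed

lemma runs_mono: "runs m orc P s c q s' \<Longrightarrow> c \<le> c' \<Longrightarrow> runs m orc P s c' q s'"
  unfolding runs_def by (meson order_trans)

text \<open>A counting loop without queries: \<open>I k\<close> describes the memory after
  \<open>k\<close> iterations, the body runs \<open>n\<close> times and the test is evaluated
  \<open>n + 1\<close> times.\<close>

lemma runs_While:
  assumes inv: "\<And>k s. k \<le> n \<Longrightarrow> I k s \<Longrightarrow> cells_le B s \<and> (bval s b \<longleftrightarrow> k < n)"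
    and step: "\<And>k s. k < n \<Longrightarrow> I k s \<Longrightarrow> \<exists>s'. runs m orc P s c 0 s' \<and> I (Suc k) s'"
    and start: "I 0 s"
  shows "\<exists>s'. runs m orc (While b P) s (n * (bweight b * B + c) + bweight b * B) 0 s' \<and> I n s'"
proof -
  \<comment> \<open>Generalized to the iterations that remain after \<open>k\<close>, for induction
    from \<open>n\<close> downwards.\<close>
  have "\<exists>s'. runs m orc (While b P) s ((n - k) * (bweight b * B + c) + bweight b * B) 0 s' \<and> I n s'"
    if "k \<le> n" "I k s" for k s
    using that
  proof (induction k arbitrary: s rule: inc_induct)
    case base
    then have "cells_le B s" "\<not> bval s b"
      using inv by auto
    then have "exec m orc (While b P) s (bcost s b) 0 s" "bcost s b \<le> bweight b * B"
      by (auto intro: exec.WhileFalse bcost_le)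
    with base show ?case
      unfolding runs_def by auto
  next
    case (step k)
    then have s: "cells_le B s" "bval s b"
      using inv[of k s] by auto
    obtain s1 T1 where 1: "exec m orc P s T1 0 s1" "T1 \<le> c" "I (Suc k) s1"
      using assms(2)[OF step.hyps(2) step.prems] unfolding runs_def by auto
    obtain s2 T2 where 2: "exec m orc (While b P) s1 T2 0 s2" "I n s2"
      "T2 \<le> (n - Suc k) * (bweight b * B + c) + bweight b * B"
      using step.IH[OF 1(3)] unfolding runs_def by auto
    have "exec m orc (While b P) s (bcost s b + T1 + T2) (0 + 0) s2"
      using s(2) 1(1) 2(1) by (rule exec.WhileTrue)
    moreover obtain r where "n - k = Suc r" "n - Suc k = r"
      using step.hyps(2) Suc_diff_Suc by metis
    then have "bcost s b + T1 + T2 \<le> (n - k) * (bweight b * B + c) + bweight b * B"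
      using bcost_le[OF s(1), of b] 1(2) 2(3) by simp
    ultimately show ?case
      using 2(2) unfolding runs_def by auto
  qed
  from this[of 0 s] start show ?thesis by simp
qed


section \<open>The program\<close>

abbreviation Var :: "name \<Rightarrow> aexp" where
  "Var a \<equiv> Cell a (Const 0)"

abbreviation Scaled :: "aexp \<Rightarrow> aexp" where
  "Scaled e \<equiv> Times (Plus (Var ''d'') (Const 1)) e"

text \<open>Rows have length n + 1, so address i (n + 2) is the diagonal entry of row
  \<open>i\<close>. Only the diagonal and the last entry of a row are written; the others are zero
  from the start.\<close>

abbreviation gss_row_body :: com where
  "gss_row_body \<equiv>
     Seq (Assign ''b'' (Times (Var ''i'') (Plus (Var ''n'') (Const 2))) (Const 1))
    (Seq (Assign ''b'' (Plus (Times (Var ''i'') (Plus (Var ''n'') (Const 1))) (Var ''n''))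
           (Scaled (Cell ''x'' (Var ''i''))))
         (Assign ''i'' (Const 0) (Plus (Var ''i'') (Const 1))))"

text \<open>The loop only ever resets \<open>found\<close> to 0, so a failed test of the last
  coordinate stays decisive.\<close>

abbreviation gss_check_body :: com where
  "gss_check_body \<equiv>
     Seq (Assign ''i'' (Const 0) (Minus (Var ''i'') (Const 1)))
         (If (And (Not (Less (Var ''d'') (Cell ''c'' (Var ''i''))))
                  (Not (Less (Cell ''c'' (Var ''i'')) (Minus (Const 0) (Var ''d'')))))
           Skip (Assign ''found'' (Const 0) (Const 0)))"

abbreviation gss_last_eq :: bexp where
  "gss_last_eq \<equiv> And (Not (Less (Cell ''c'' (Var ''n'')) (Scaled (Var ''tau''))))
                      (Not (Less (Scaled (Var ''tau'')) (Cell ''c'' (Var ''n''))))"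

text \<open>The initial memory supplies the zeros of the target and the start values 0 of
  \<open>i\<close> and \<open>found\<close>.\<close>

abbreviation gss_program :: com where
  "gss_program \<equiv>
     Seq (Assign ''t'' (Var ''n'') (Scaled (Var ''tau'')))
    (Seq (While (Less (Var ''i'') (Var ''n'')) gss_row_body)
    (Seq (Query ''b'' (Var ''n'') ''t'' ''c'')
    (Seq (If gss_last_eq (Assign ''found'' (Const 0) (Const 1)) Skip)
         (While (Less (Const 0) (Var ''i'')) gss_check_body))))"

lemma bits_consts [simp]: "bits 0 = 1" "bits 1 = 2" "bits 2 = 3"
proof -
  show "bits 0 = 1"
    by (simp add: bits_def)
  show "bits 1 = 2"
    using bits_le_iff[of 1 0] bits_le_iff[of 1 1] by simp
  show "bits 2 = 3"
    using bits_le_iff[of 2 1] bits_le_iff[of 2 2] by simp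
qed

section \<open>The first loop: writing the basis\<close>

definition gss_rows_inv :: "nat \<Rightarrow> nat \<Rightarrow> int vec \<Rightarrow> int \<Rightarrow> nat \<Rightarrow> nat \<Rightarrow> memory \<Rightarrow> bool" where
  "gss_rows_inv d n x \<tau> B k s \<longleftrightarrow>
     cells_le B s \<and> s ''d'' 0 = int d \<and> s ''n'' 0 = int n \<and> s ''tau'' 0 = \<tau> \<and>
     s ''found'' 0 = 0 \<and> s ''i'' 0 = int k \<and>
     (\<forall>i<n. s ''x'' (int i) = x $ i) \<and>
     (\<forall>j\<le>n. s ''t'' (int j) = (if j = n then (int d + 1) * \<tau> else 0)) \<and>
     (\<forall>i<k. \<forall>j\<le>n. s ''b'' (int (i * (n + 1) + j)) =
        (if j = i then 1 else if j = n then (int d + 1) * x $ i else 0)) \<and>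
     (\<forall>z\<ge>k * (n + 1). s ''b'' (int z) = 0)"

text \<open>Bracketed like the nested \<open>Seq\<close> of the loop body, so that the bounds of the
  three assignments match it once \<open>B\<close> is distributed.\<close>

definition gss_rows_weight :: nat where
  "gss_rows_weight =
     (aweight (Times (Var ''i'') (Plus (Var ''n'') (Const 2))))\<^sup>2 + (aweight (Const 1))\<^sup>2 +
     ((aweight (Plus (Times (Var ''i'') (Plus (Var ''n'') (Const 1))) (Var ''n'')))\<^sup>2 +
      (aweight (Scaled (Cell ''x'' (Var ''i''))))\<^sup>2 +
      ((aweight (Const 0))\<^sup>2 + (aweight (Plus (Var ''i'') (Const 1)))\<^sup>2))"

text \<open>The values written are 1, \<open>(int d + 1) * x $ k\<close> and k + 1, which is at most
  n; all fit into \<open>B\<close> bits. The invariant keeps the unwritten part of \<open>b\<close>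
  at zero, which supplies the rest of the new row.\<close>

lemma gss_rows_step:
  assumes k: "k < n" and inv: "gss_rows_inv d n x \<tau> B k s"
    and xB: "bits ((int d + 1) * x $ k) \<le> B" and nB: "bits (int n) \<le> B" and B: "2 \<le> B"
  shows "\<exists>s'. runs m orc gss_row_body s (gss_rows_weight * B) 0 s' \<and>
    gss_rows_inv d n x \<tau> B (Suc k) s'"
proof -
  have s: "cells_le B s" "s ''d'' 0 = int d" "s ''n'' 0 = int n" "s ''tau'' 0 = \<tau>"
    "s ''found'' 0 = 0" "s ''i'' 0 = int k" "\<And>i. i < n \<Longrightarrow> s ''x'' (int i) = x $ i"
    "\<And>j. j \<le> n \<Longrightarrow> s ''t'' (int j) = (if j = n then (int d + 1) * \<tau> else 0)"
    and old: "\<And>i j. i < k \<Longrightarrow> j \<le> n \<Longrightarrow> s ''b'' (int (i * (n + 1) + j)) =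
        (if j = i then 1 else if j = n then (int d + 1) * x $ i else 0)"
    and zero: "\<And>z. k * (n + 1) \<le> z \<Longrightarrow> s ''b'' (int z) = 0"
    using inv by (auto simp: gss_rows_inv_def)
  define s1 where "s1 = s(''b'' := (s ''b'')(int (k * (n + 1) + k) := 1))"
  define s2 where "s2 = s1(''b'' := (s1 ''b'')(int (k * (n + 1) + n) := (int d + 1) * x $ k))"
  define s3 where "s3 = s2(''i'' := (s2 ''i'')(0 := int k + 1))"
  have 1: "cells_le B s1"
    unfolding s1_def using B by (intro cells_le_update s) simp
  have 2: "cells_le B s2"
    unfolding s2_def using xB by (intro cells_le_update 1)
  have "bits (int k + 1) \<le> bits (int n)"
    using k by (intro bits_mono) simp
  then have 3: "cells_le B s3"
    unfolding s3_def using nB by (intro cells_le_update 2) simp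
  let ?w1 = "(aweight (Times (Var ''i'') (Plus (Var ''n'') (Const 2))))\<^sup>2 + (aweight (Const 1))\<^sup>2"
  have "runs m orc gss_row_body s (gss_rows_weight * B) (0 + (0 + 0)) s3"
    unfolding gss_rows_weight_def add_mult_distrib[of ?w1] add_mult_distrib[of "_ + (aweight (Scaled _))\<^sup>2"]
    by (intro runs_Seq[where s' = s1] runs_Seq[where s' = s2] runs_Assign 1 2 s(1))
      (simp_all add: s1_def s2_def s3_def s(2-7) k algebra_simps)
  moreover have "gss_rows_inv d n x \<tau> B (Suc k) s3"
  proof -
    have b: "s3 ''b'' (int z) = (if z = k * (n + 1) + n then (int d + 1) * x $ k
        else if z = k * (n + 1) + k then 1 else s ''b'' (int z))" for z
      by (simp add: s3_def s2_def s1_def del: of_nat_add of_nat_mult)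
    \<comment> \<open>Neither of the two writes, both at or beyond this bound, touches an earlier
      row.\<close>
    have row: "i * (n + 1) + j < k * (n + 1)" if "i < k" "j \<le> n" for i j
    proof -
      have "i * (n + 1) + j < Suc i * (n + 1)"
        using that by simp
      also have "\<dots> \<le> k * (n + 1)"
        using that by (intro mult_le_mono1) simp
      finally show ?thesis .
    qed
    have "s3 ''b'' (int (i * (n + 1) + j)) =
        (if j = i then 1 else if j = n then (int d + 1) * x $ i else 0)"
      if "i < Suc k" "j \<le> n" for i j
    proof (cases "i < k")
      case True
      with row[of i j] that old show ?thesis
        unfolding b by simp
    next
      \<comment> \<open>In row \<open>k\<close> itself the two written addresses are distinct since
        \<open>k < n\<close>; elsewhere the old zeros remain.\<close>
      case False
      with that have "i = k" by simp
      with that k zero[of "k * (n + 1) + j"] show ?thesis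
        unfolding b by auto
    qed
    moreover have "s3 ''b'' (int z) = 0" if "Suc k * (n + 1) \<le> z" for z
      using that k zero[of z] unfolding b by simp
    moreover have "s3 ''d'' 0 = int d" "s3 ''n'' 0 = int n" "s3 ''tau'' 0 = \<tau>"
      "s3 ''found'' 0 = 0" "s3 ''i'' 0 = int (Suc k)" "s3 ''x'' = s ''x''" "s3 ''t'' = s ''t''"
      by (simp_all add: s3_def s2_def s1_def s(2-6))
    ultimately show ?thesis
      unfolding gss_rows_inv_def using 3 s(7,8) by simp
  qed
  ultimately show ?thesis
    by auto
qed

section \<open>The second loop: checking the reply\<close>

text \<open>The check runs downwards, so that the counter need not be reset after the first loop: after \<open>k\<close>
  iterations it stands at \<open>n - k\<close>.\<close>

definition gss_check_inv :: "nat \<Rightarrow> nat \<Rightarrow> int vec \<Rightarrow> bool \<Rightarrow> nat \<Rightarrow> nat \<Rightarrow> memory \<Rightarrow> bool" where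
  "gss_check_inv d n v E B k s \<longleftrightarrow>
     cells_le B s \<and> s ''d'' 0 = int d \<and> k \<le> n \<and> s ''i'' 0 = int (n - k) \<and>
     (\<forall>j<n. s ''c'' (int j) = v $ j) \<and>
     s ''found'' 0 = (if E \<and> (\<forall>j. n - k \<le> j \<and> j < n \<longrightarrow> \<bar>v $ j\<bar> \<le> int d) then 1 else 0)"

definition gss_check_weight :: nat where
  "gss_check_weight =
     ((aweight (Const 0))\<^sup>2 + (aweight (Minus (Var ''i'') (Const 1)))\<^sup>2) +
     (bweight (And (Not (Less (Var ''d'') (Cell ''c'' (Var ''i''))))
                  (Not (Less (Cell ''c'' (Var ''i'')) (Minus (Const 0) (Var ''d'')))))
      + ((aweight (Const 0))\<^sup>2 + (aweight (Const 0))\<^sup>2))"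

lemma gss_check_step:
  assumes k: "k < n" and inv: "gss_check_inv d n v E B k s" and nB: "bits (int n) \<le> B"
  shows "\<exists>s'. runs m orc gss_check_body s (gss_check_weight * B) 0 s' \<and>
    gss_check_inv d n v E B (Suc k) s'"
proof -
  have s: "cells_le B s" "s ''d'' 0 = int d" "s ''i'' 0 = int (n - k)"
    "\<And>j. j < n \<Longrightarrow> s ''c'' (int j) = v $ j"
    and found: "s ''found'' 0 = (if E \<and> (\<forall>j. n - k \<le> j \<and> j < n \<longrightarrow> \<bar>v $ j\<bar> \<le> int d) then 1 else 0)"
    using inv by (auto simp: gss_check_inv_def)
  let ?j = "n - Suc k"
  have j: "?j < n" "int (n - k) - 1 = int ?j"
    using k by auto
  define s1 where "s1 = s(''i'' := (s ''i'')(0 := int ?j))"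
  define s2 where "s2 = (if \<bar>v $ ?j\<bar> \<le> int d then s1 else s1(''found'' := (s1 ''found'')(0 := 0)))"
  let ?b = "And (Not (Less (Var ''d'') (Cell ''c'' (Var ''i''))))
    (Not (Less (Cell ''c'' (Var ''i'')) (Minus (Const 0) (Var ''d''))))"
  have "bits (int ?j) \<le> bits (int n)"
    by (intro bits_mono) simp
  then have 1: "cells_le B s1"
    unfolding s1_def using nB by (intro cells_le_update s) simp
  have 2: "cells_le B s2"
    unfolding s2_def using 1 by (auto intro!: cells_le_update simp: cells_le_def)
  have b: "bval s1 ?b \<longleftrightarrow> \<bar>v $ ?j\<bar> \<le> int d"
  proof -
    have "s1 ''c'' (s1 ''i'' 0) = v $ ?j" "s1 ''d'' 0 = int d"
      using s(4)[OF j(1)] by (simp_all add: s1_def s(2) del: of_nat_diff)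
    then show ?thesis
      by auto
  qed
  \<comment> \<open>The common bound is that of the assignment, which equals \<open>2 * B\<close>
    and so covers \<open>Skip\<close> as well.\<close>
  have "runs m orc (if bval s1 ?b then Skip else Assign ''found'' (Const 0) (Const 0)) s1
      (((aweight (Const 0))\<^sup>2 + (aweight (Const 0))\<^sup>2) * B) 0 s2"
  proof (cases "bval s1 ?b")
    case True
    then have "s2 = s1"
      unfolding b by (simp add: s2_def)
    then show ?thesis
      unfolding if_P[OF True] using runs_mono[OF runs_Skip[OF 1]] by simp
  next
    case False
    then have "s2 = s1(''found'' := (s1 ''found'')(0 := 0))"
      unfolding b by (simp add: s2_def)
    then show ?thesis
      unfolding if_not_P[OF False] by (intro runs_Assign 1) simp
  qed
  then have "runs m orc gss_check_body s (gss_check_weight * B) (0 + 0) s2"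
    unfolding gss_check_weight_def add_mult_distrib[of "_ + (aweight (Minus _ _))\<^sup>2"] add_mult_distrib[of "bweight _"]
    by (intro runs_Seq[where s' = s1] runs_If 1 runs_Assign s(1)) (simp_all add: s1_def s(3) j(2))
  moreover have "gss_check_inv d n v E B (Suc k) s2"
  proof -
    \<comment> \<open>The tested range grows downwards by exactly the index that this iteration
      examines.\<close>
    have "(n - Suc k \<le> j \<and> j < n) \<longleftrightarrow> (n - k \<le> j \<and> j < n) \<or> j = ?j" for j
      using k by auto
    then have "(\<forall>j. n - Suc k \<le> j \<and> j < n \<longrightarrow> \<bar>v $ j\<bar> \<le> int d) \<longleftrightarrow>
        (\<forall>j. n - k \<le> j \<and> j < n \<longrightarrow> \<bar>v $ j\<bar> \<le> int d) \<and> \<bar>v $ ?j\<bar> \<le> int d"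
      by auto
    moreover have "s2 ''d'' 0 = int d" "s2 ''i'' 0 = int ?j" "s2 ''c'' = s ''c''"
      "s2 ''found'' 0 = (if \<bar>v $ ?j\<bar> \<le> int d then s ''found'' 0 else 0)"
      by (simp_all add: s2_def s1_def s(2))
    ultimately show ?thesis
      unfolding gss_check_inv_def using 2 k s(4) found by simp
  qed
  ultimately show ?thesis
    by auto
qed

section \<open>The query and the total time\<close>

lemma vec_bits_le:
  assumes "\<And>i. i < dim_vec v \<Longrightarrow> bits (v $ i) \<le> B"
  shows "vec_bits v \<le> dim_vec v * B"
  using sum_bounded_above[of "{..<dim_vec v}" "\<lambda>i. bits (v $ i)" B] assms
  by (simp add: vec_bits_def)

text \<open>The query handles \<open>l\<close> basis vectors, the target and the reply, each with
  \<open>m\<close> entries. The reply does not come from memory, so its entries carry a bound of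
  their own.\<close>

lemma runs_Query:
  assumes s: "cells_le B s" and k: "aval s k = int l"
    and basis: "lattice_basis m (map (map_vec real_of_int) (read_basis m s b l))"
    and reply: "orc (map (map_vec real_of_int) (read_basis m s b l))
      (map_vec real_of_int (read_vec m s t 0)) = map_vec real_of_int v"
    and v: "dim_vec v = m" "\<And>i. i < m \<Longrightarrow> bits (v $ i) \<le> B"
  shows "runs m orc (Query b k t a) s ((aweight k)\<^sup>2 * B + l * (m * B) + m * B + m * B) 1
    (write_vec v a s)"
proof -
  have read: "vec_bits (read_vec m s c i) \<le> m * B" for c i
    using vec_bits_le[of "read_vec m s c i" B] s by (simp add: read_vec_def cells_le_def)
  have "sum_list (map vec_bits (read_basis m s b l)) \<le> l * (m * B)"
    using sum_list_mono[of "[0..<l]" "\<lambda>i. vec_bits (read_vec m s b (int (i * m)))" "\<lambda>_. m * B"] read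
    by (simp add: read_basis_def comp_def sum_list_triv del: of_nat_mult)
  moreover have "vec_bits v \<le> m * B"
    using vec_bits_le[of v B] v by simp
  moreover have "exec m orc (Query b k t a) s (acost s k + sum_list (map vec_bits (read_basis m s b l)) +
      vec_bits (read_vec m s t 0) + vec_bits v) 1 (write_vec v a s)"
    using basis reply by (intro exec.Query) (simp_all add: k)
  ultimately show ?thesis
    unfolding runs_def using acost_le[OF s, of k] read[of t 0] by (meson add_mono)
qed

text \<open>The coefficient of (n + 1)^2 B in the total time. Each loop test counts twice, for the
  iterations and for the final evaluation; the 3 pays for the vectors handled by the query.\<close>

definition gss_time_weight :: nat where
  "gss_time_weight = ((aweight (Var ''n''))\<^sup>2 + (aweight (Scaled (Var ''tau'')))\<^sup>2) +
     2 * bweight (Less (Var ''i'') (Var ''n'')) + gss_rows_weight + ((aweight (Var ''n''))\<^sup>2 + 3) +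
     (bweight gss_last_eq + ((aweight (Const 0))\<^sup>2 + (aweight (Const 1))\<^sup>2)) +
     2 * bweight (Less (Const 0) (Var ''i'')) + gss_check_weight"

text \<open>All numbers in memory and in the reply keep within \<open>B\<close> bits, with
  \<open>B\<close> linear in the input size. The rest is counting: (n + 1)^2 B per unit of weight,
  with n + 1 at most the input size, makes the time cubic.\<close>

lemma gss_program_runs:
  assumes d: "0 < d" and \<epsilon>: "0 < \<epsilon>" "\<epsilon> < 1 / real d"
    and orc: "approx_cvp_oracle (1 + 1 / real d - \<epsilon>) (n + 1) orc"
    and x: "x \<in> carrier_vec n"
  shows "\<exists>s. runs (n + 1) orc gss_program (gss_input d n x \<tau>)
      (gss_time_weight * (8 * gss_input_bits d n x \<tau> ^ 3)) 1 s \<and>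
    solves_gss {- int d .. int d} x \<tau> (gss_output n s)"
proof -
  let ?L = "gss_input_bits d n x \<tau>" and ?K = "int d + 1" and ?s = "gss_input d n x \<tau>"
  \<comment> \<open>The factor 8 is set by the reply, whose entries may need 7 bits more than
    \<open>d\<close> and \<tau> together, and 7 + \<open>?L\<close> is at most
    \<open>8 * ?L\<close>.\<close>
  define B where "B = 8 * ?L"
  have xk: "bits (x $ k) \<le> vec_bits x" if "k < n" for k
    unfolding vec_bits_def using that x by (intro member_le_sum) auto
  have L: "1 \<le> ?L" "bits (int d) \<le> ?L" "bits (int n) \<le> ?L" "bits \<tau> \<le> ?L" "vec_bits x \<le> ?L"
    using bits_pos[of "int d"] by (auto simp: gss_input_bits_def)
  have Kbits: "bits (?K * y) \<le> bits (int d) + 2 + bits y" for y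
    using bits_mult[of ?K y] bits_add_le_abs[of ?K "int d" 1] by simp
  have KxB: "bits (?K * x $ k) \<le> B" if "k < n" for k
    using Kbits[of "x $ k"] xk[OF that] L by (simp add: B_def)
  have K\<tau>B: "bits (?K * \<tau>) \<le> B"
    using Kbits[of \<tau>] L by (simp add: B_def)
  have dB: "1 \<le> B" "bits (int d) \<le> B" "bits \<tau> \<le> B" "2 \<le> B" and nB: "bits (int n) \<le> B"
    using L by (auto simp: B_def)
  \<comment> \<open>Every entry of \<open>x\<close> takes at least one bit, so the input size bounds
    \<open>n\<close> itself and not merely its bit length.\<close>
  have "n \<le> vec_bits x"
    using sum_bounded_below[of "{..<n}" 1 "\<lambda>i. bits (x $ i)"] bits_pos x by (simp add: vec_bits_def)
  then have nL: "n + 1 \<le> ?L"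
    using bits_pos[of "int d"] by (simp add: gss_input_bits_def)
  have s: "cells_le B ?s"
    unfolding cells_le_def
  proof (intro conjI allI)
    show "bits (?s a z) \<le> B" for a z
    proof -
      have "bits (x $ nat z) \<le> B" if "0 \<le> z" "z < int n" for z
        using L xk[of "nat z"] that by (simp add: B_def nat_less_iff)
      from this[of z] this[of 0] show ?thesis
        using dB nB x by (auto simp: gss_input_def)
    qed
  qed (use L in \<open>simp add: B_def\<close>)
  define s0 where "s0 = ?s(''t'' := (?s ''t'')(int n := ?K * \<tau>))"
  have s0: "cells_le B s0"
    unfolding s0_def using K\<tau>B by (intro cells_le_update s)
  have run0: "runs (n + 1) orc (Assign ''t'' (Var ''n'') (Scaled (Var ''tau''))) ?s
      (((aweight (Var ''n''))\<^sup>2 + (aweight (Scaled (Var ''tau'')))\<^sup>2) * B) 0 s0"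
    by (rule runs_Assign[OF s]) (simp add: s0_def gss_input_def)
  have "\<exists>s1. runs (n + 1) orc (While (Less (Var ''i'') (Var ''n'')) gss_row_body) s0
      (n * (bweight (Less (Var ''i'') (Var ''n'')) * B + gss_rows_weight * B) +
        bweight (Less (Var ''i'') (Var ''n'')) * B) 0 s1 \<and> gss_rows_inv d n x \<tau> B n s1"
  proof (rule runs_While[where I = "gss_rows_inv d n x \<tau> B"])
    show "gss_rows_inv d n x \<tau> B 0 s0"
      unfolding gss_rows_inv_def using s0 x by (auto simp: s0_def gss_input_def)
    show "\<exists>s'. runs (n + 1) orc gss_row_body s (gss_rows_weight * B) 0 s' \<and> gss_rows_inv d n x \<tau> B (Suc k) s'"
      if "k < n" "gss_rows_inv d n x \<tau> B k s" for k s
      using that KxB[OF that(1)] nB dB(4) by (rule gss_rows_step)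
  qed (simp add: gss_rows_inv_def)
  then obtain s1 where run1: "runs (n + 1) orc (While (Less (Var ''i'') (Var ''n'')) gss_row_body) s0
      (n * (bweight (Less (Var ''i'') (Var ''n'')) * B + gss_rows_weight * B) +
        bweight (Less (Var ''i'') (Var ''n'')) * B) 0 s1"
    and inv1: "gss_rows_inv d n x \<tau> B n s1"
    by blast
  have s1: "cells_le B s1" "s1 ''d'' 0 = int d" "s1 ''n'' 0 = int n" "s1 ''tau'' 0 = \<tau>"
    "s1 ''found'' 0 = 0" "s1 ''i'' 0 = int n"
    "\<And>j. j \<le> n \<Longrightarrow> s1 ''t'' (int j) = (if j = n then ?K * \<tau> else 0)"
    "\<And>i j. i < n \<Longrightarrow> j \<le> n \<Longrightarrow> s1 ''b'' (int (i * (n + 1) + j)) =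
        (if j = i then 1 else if j = n then ?K * x $ i else 0)"
    using inv1 by (auto simp: gss_rows_inv_def)
  have basis: "read_basis (n + 1) s1 ''b'' n = gss_basis d x"
    using x s1(8) unfolding read_basis_def gss_basis_def read_vec_def of_nat_add[symmetric]
    by (intro map_cong eq_vecI) auto
  have target: "read_vec (n + 1) s1 ''t'' 0 = gss_target d n \<tau>"
    using s1(7) by (auto simp: read_vec_def gss_target_def)
  obtain v where v: "v \<in> carrier_vec (n + 1)"
    "orc (map (map_vec real_of_int) (gss_basis d x)) (map_vec real_of_int (gss_target d n \<tau>))
      = map_vec real_of_int v"
    "\<And>i. i \<le> n \<Longrightarrow> \<bar>v $ i\<bar> \<le> 3 * (?K * \<bar>\<tau>\<bar>)"
    "solves_gss {- int d .. int d} x \<tau>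
      (if v $ n = ?K * \<tau> \<and> (\<forall>i<n. \<bar>v $ i\<bar> \<le> int d) then Some (vec n (($) v)) else None)"
    using gss_oracle_reply[OF d \<epsilon> orc x, of \<tau>] by blast
  have vB: "bits (v $ i) \<le> B" if "i < n + 1" for i
  proof -
    have "bits (v $ i) \<le> bits (3 * (?K * \<tau>))"
      using v(3)[of i] that by (intro bits_mono) (simp add: abs_mult)
    also have "\<dots> \<le> bits 3 + bits (?K * \<tau>)"
      by (rule bits_mult)
    \<comment> \<open>Writing 3 as 1 + 2 costs 5 bits, and the passage from \<open>d\<close> to
      \<open>?K\<close> costs 2 more.\<close>
    also have "\<dots> \<le> (bits 1 + bits 2) + (bits (int d) + 2 + bits \<tau>)"
      using Kbits[of \<tau>] by (intro add_mono bits_add_le_abs) simp_all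
    also have "\<dots> \<le> B"
      using L by (simp add: B_def gss_input_bits_def)
    finally show ?thesis .
  qed
  define s2 where "s2 = write_vec v ''c'' s1"
  have run2: "runs (n + 1) orc (Query ''b'' (Var ''n'') ''t'' ''c'') s1
      ((aweight (Var ''n''))\<^sup>2 * B + n * ((n + 1) * B) + (n + 1) * B + (n + 1) * B) 1 s2"
    unfolding s2_def using v(1,2) vB lattice_basis_gss_basis[of x d] x
    by (intro runs_Query s1) (simp_all add: basis[simplified] target[simplified] s1(3))
  have s2: "cells_le B s2"
    using s1(1) vB v(1) by (auto simp: cells_le_def s2_def write_vec_def)
  have s2c: "s2 ''c'' (int j) = v $ j" if "j \<le> n" for j
    using v(1) that by (simp add: s2_def write_vec_def)
  have s2': "s2 ''d'' 0 = int d" "s2 ''n'' 0 = int n" "s2 ''tau'' 0 = \<tau>"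
    "s2 ''found'' 0 = 0" "s2 ''i'' 0 = int n"
    using s1 by (simp_all add: s2_def write_vec_def)
  let ?E = "v $ n = ?K * \<tau>"
  define s3 where "s3 = (if ?E then s2(''found'' := (s2 ''found'')(0 := 1)) else s2)"
  have s3: "cells_le B s3"
    unfolding s3_def using s2 L by (auto intro!: cells_le_update simp: B_def)
  have E: "bval s2 gss_last_eq \<longleftrightarrow> ?E"
    by (auto simp: s2' s2c)
  have "runs (n + 1) orc (if bval s2 gss_last_eq then Assign ''found'' (Const 0) (Const 1) else Skip) s2
      (((aweight (Const 0))\<^sup>2 + (aweight (Const 1))\<^sup>2) * B) 0 s3"
  proof (cases "bval s2 gss_last_eq")
    case True
    then have "s3 = s2(''found'' := (s2 ''found'')(0 := 1))"
      unfolding E by (simp add: s3_def)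
    then show ?thesis
      unfolding if_P[OF True] by (intro runs_Assign s2) simp
  next
    case False
    then have "s3 = s2"
      unfolding E by (simp add: s3_def)
    then show ?thesis
      unfolding if_not_P[OF False] using runs_mono[OF runs_Skip[OF s2]] by simp
  qed
  then have run3: "runs (n + 1) orc (If gss_last_eq (Assign ''found'' (Const 0) (Const 1)) Skip) s2
      (bweight gss_last_eq * B + ((aweight (Const 0))\<^sup>2 + (aweight (Const 1))\<^sup>2) * B) 0 s3"
    by (rule runs_If[OF s2])
  have "\<exists>s4. runs (n + 1) orc (While (Less (Const 0) (Var ''i'')) gss_check_body) s3
      (n * (bweight (Less (Const 0) (Var ''i'')) * B + gss_check_weight * B) +
        bweight (Less (Const 0) (Var ''i'')) * B) 0 s4 \<and> gss_check_inv d n v ?E B n s4"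
  proof (rule runs_While[where I = "gss_check_inv d n v ?E B"])
    \<comment> \<open>The range of tested indices is still empty, so \<open>found\<close> records
      \<open>?E\<close> alone.\<close>
    show "gss_check_inv d n v ?E B 0 s3"
      unfolding gss_check_inv_def using s3 by (auto simp: s3_def s2' s2c)
    show "\<exists>s'. runs (n + 1) orc gss_check_body s (gss_check_weight * B) 0 s' \<and> gss_check_inv d n v ?E B (Suc k) s'"
      if "k < n" "gss_check_inv d n v ?E B k s" for k s
      using that nB by (rule gss_check_step)
  qed (auto simp: gss_check_inv_def)
  then obtain s4 where run4: "runs (n + 1) orc (While (Less (Const 0) (Var ''i'')) gss_check_body) s3
      (n * (bweight (Less (Const 0) (Var ''i'')) * B + gss_check_weight * B) +
        bweight (Less (Const 0) (Var ''i'')) * B) 0 s4"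
    and inv4: "gss_check_inv d n v ?E B n s4"
    by blast
  have "read_vec n s4 ''c'' 0 = vec n (($) v)"
    using inv4 by (auto simp: read_vec_def gss_check_inv_def)
  then have "gss_output n s4 =
      (if ?E \<and> (\<forall>i<n. \<bar>v $ i\<bar> \<le> int d) then Some (vec n (($) v)) else None)"
    using inv4 by (simp add: gss_output_def gss_check_inv_def)
  then have "solves_gss {- int d .. int d} x \<tau> (gss_output n s4)"
    using v(4) by simp
  moreover have "runs (n + 1) orc gss_program ?s (gss_time_weight * (8 * ?L ^ 3)) 1 s4"
  proof -
    let ?N = "(n + 1) * (n + 1)"
    \<comment> \<open>Work done once and work done \<open>n\<close> times are absorbed into the same
      quantity.\<close>
    have scale: "w * B \<le> w * (?N * B)" "n * (w * B) \<le> w * (?N * B)" for w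
    proof -
      show "w * B \<le> w * (?N * B)"
        by (intro mult_le_mono2) simp
      have "n * (w * B) = w * (n * B)"
        by simp
      also have "\<dots> \<le> w * (?N * B)"
        by (intro mult_le_mono mult_le_mono1) simp_all
      finally show "n * (w * B) \<le> w * (?N * B)" .
    qed
    have query: "n * ((n + 1) * B) + (n + 1) * B + (n + 1) * B \<le> 3 * (?N * B)"
      by (simp add: algebra_simps)
    have "w1 * B + ((n * (w2 * B + w3 * B) + w2 * B) + ((w4 * B + n * ((n + 1) * B) + (n + 1) * B + (n + 1) * B)
        + ((w5 * B + w6 * B) + (n * (w7 * B + w8 * B) + w7 * B))))
        \<le> (w1 + 2 * w2 + w3 + (w4 + 3) + (w5 + w6) + 2 * w7 + w8) * (?N * B)" for w1 w2 w3 w4 w5 w6 w7 w8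
      using query scale(1)[of w1] scale[of w2] scale(2)[of w3] scale(1)[of w4] scale(1)[of w5]
        scale(1)[of w6] scale[of w7] scale(2)[of w8]
      unfolding add_mult_distrib add_mult_distrib2[of n] mult.assoc[of 2] by linarith
    then have "runs (n + 1) orc gss_program ?s (gss_time_weight * (?N * B)) (0 + (0 + (1 + (0 + 0)))) s4"
      unfolding gss_time_weight_def
      by (rule runs_mono[OF runs_Seq[OF run0 runs_Seq[OF run1 runs_Seq[OF run2 runs_Seq[OF run3 run4]]]]])
    moreover have "?N * B \<le> 8 * ?L ^ 3"
    proof -
      have "?N * B \<le> (?L * ?L) * B"
        by (intro mult_le_mono nL) simp
      then show ?thesis
        by (simp add: B_def power3_eq_cube)
    qed
    ultimately show ?thesis
      using runs_mono[OF _ mult_le_mono2] by simp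
  qed
  ultimately show ?thesis
    by blast
qed

theorem theorem4p2:
  shows "\<exists>(P :: com) (p :: nat poly).
    \<forall>(d :: nat) (n :: nat) (\<epsilon> :: real) (orc :: cvp_oracle) (x :: int vec) (\<tau> :: int).
      0 < d \<longrightarrow> 0 < n \<longrightarrow> 0 < \<epsilon> \<longrightarrow> \<epsilon> < 1 / real d \<longrightarrow>
      approx_cvp_oracle (1 + 1 / real d - \<epsilon>) (n + 1) orc \<longrightarrow>
      x \<in> carrier_vec n \<longrightarrow>
      (\<exists>T s. exec (n + 1) orc P (gss_input d n x \<tau>) T 1 s \<and>
             T \<le> poly p (gss_input_bits d n x \<tau>) \<and>
             solves_gss {- int d .. int d} x \<tau> (gss_output n s))"
\<comment> \<open>Program and polynomial are fixed before all parameters: \<open>d\<close> and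
  \<open>n\<close> are read from memory, and the weight is a constant.\<close>
proof (rule exI[of _ gss_program], rule exI[of _ "monom (gss_time_weight * 8) 3"], intro allI impI)
  fix d n :: nat and \<epsilon> :: real and orc :: cvp_oracle and x :: "int vec" and \<tau> :: int
  assume "0 < d" "0 < \<epsilon>" "\<epsilon> < 1 / real d" "approx_cvp_oracle (1 + 1 / real d - \<epsilon>) (n + 1) orc"
    "x \<in> carrier_vec n"
  then show "\<exists>T s. exec (n + 1) orc gss_program (gss_input d n x \<tau>) T 1 s \<and>
      T \<le> poly (monom (gss_time_weight * 8) 3) (gss_input_bits d n x \<tau>) \<and>
      solves_gss {- int d .. int d} x \<tau> (gss_output n s)"
    using gss_program_runs[of d \<epsilon> n orc x \<tau>] by (auto simp: runs_def poly_monom mult.assoc)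
qed

end
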